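(* Every finite positively-edge-weighted undirected graph $G=(V,E,\omega)$ is ranked-majority $1$-paintable, i.e. Painter has a winning strategy in the ranked-majority $\lambda$-painting game on $G$ with $\lambda(v)=1$ for every $v\in V$.
   Context: A positively-edge-weighted directed graph is a tuple $D=(V,E,\omega)$ with $V$ a finite vertex set, $E$ a set of ordered pairs $vw$ of distinct vertices, and $\omega:E\to\mathbb{R}_{>0}$. A positively-edge-weighted undirected graph is such a graph that is symmetric: $vw\in E$ implies $wv\in E$ and $\omega(vw)=\omega(wv)$. Given a function $\lambda$ assigning a positive real $\lambda(v)$ to each vertex, the ranked-majority $\lambda$-painting game on $D$ is played in rounds by Lister and Painter; initially all vertices are uncolored. In round $i=1,2,\dots$, Lister presents a non-empty set $X_i$ of uncolored vertices together with a function $\tau_i$ assigning a non-negative real $\tau_i(v)$ to each $v\in X_i$. Painter responds with a subset $Y_i\subseteq X_i$, whose vertices receive color $i$, such that for every $v\in Y_i$: $\sum_{vw\in E,\,w\in Y_i}\omega(vw)\le \tau_i(v)\cdot\sum_{vw\in E}\omega(vw)$. Painter wins after round $m$ if $\bigcup_{i\le m}Y_i=V$. Lister wins after round $m$ if some vertex $v\notin\bigcup_{i\le m}Y_i$ satisfies $\sum_{i:\,v\in X_i}\tau_i(v)\ge\lambda(v)$. Otherwise the game continues. $D$ is ranked-majority $\lambda$-paintable if Painter has a winning strategy; "ranked-majority $c$-paintable" for a constant $c$ means $\lambda\equiv c$. *)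

theory Defs
  imports Complex_Main "Graph_Theory.Pair_Digraph" "Graph_Theory.Weighted_Graph"
begin

text \<open>\<^locale>\<open>pair_digraph\<close> is a finite loopless digraph whose arcs are ordered pairs of vertices;
  \<^locale>\<open>pair_graph\<close> is such a digraph with a symmetric arc relation.\<close>

locale pos_weighted_digraph = pair_digraph D
  for D :: "'a pair_pre_digraph" +
  fixes \<omega> :: "('a \<times> 'a) weight_fun"
  assumes weight_pos: "e \<in> parcs D \<Longrightarrow> \<omega> e > 0"

locale pos_weighted_graph = pos_weighted_digraph D \<omega> + pair_graph D
  for D :: "'a pair_pre_digraph" and \<omega> :: "('a \<times> 'a) weight_fun" +
  assumes weight_sym: "(v, w) \<in> parcs D \<Longrightarrow> \<omega> (v, w) = \<omega> (w, v)"

text \<open>A round consists of \<open>X\<^sub>i\<close>, \<open>\<tau>\<^sub>i\<close> (whose values outside \<open>X\<^sub>i\<close> are irrelevant) and \<open>Y\<^sub>i\<close>. A history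
  is the list of the rounds played so far, the oldest first; the color given to the vertices
  in \<open>Y\<^sub>i\<close> is the position of the round in this list.\<close>

datatype 'a round =
  Round (presented: "'a set") (tolerance: "'a \<Rightarrow> real") (painted: "'a set")

definition colored :: "'a round list \<Rightarrow> 'a set" where
  "colored h = (\<Union>r\<in>set h. painted r)"

definition lister_legal ::
    "'a pair_pre_digraph \<Rightarrow> 'a round list \<Rightarrow> 'a set \<Rightarrow> ('a \<Rightarrow> real) \<Rightarrow> bool" where
  "lister_legal D h X \<tau> \<longleftrightarrow>
     X \<noteq> {} \<and> X \<subseteq> pverts D - colored h \<and> (\<forall>v\<in>X. 0 \<le> \<tau> v)"

definition painter_legal ::
    "'a pair_pre_digraph \<Rightarrow> ('a \<times> 'a) weight_fun \<Rightarrow> 'a set \<Rightarrow> ('a \<Rightarrow> real) \<Rightarrow> 'a set \<Rightarrow> bool" where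
  "painter_legal D \<omega> X \<tau> Y \<longleftrightarrow>
     Y \<subseteq> X \<and>
     (\<forall>v\<in>Y. (\<Sum>w | (v, w) \<in> parcs D \<and> w \<in> Y. \<omega> (v, w))
              \<le> \<tau> v * (\<Sum>w | (v, w) \<in> parcs D. \<omega> (v, w)))"

definition painter_won :: "'a pair_pre_digraph \<Rightarrow> 'a round list \<Rightarrow> bool" where
  "painter_won D h \<longleftrightarrow> colored h = pverts D"

definition lister_won ::
    "'a pair_pre_digraph \<Rightarrow> ('a \<Rightarrow> real) \<Rightarrow> 'a round list \<Rightarrow> bool" where
  "lister_won D lam h \<longleftrightarrow>
     (\<exists>v \<in> pverts D - colored h.
        (\<Sum>i | i < length h \<and> v \<in> presented (h ! i). tolerance (h ! i) v) \<ge> lam v)"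

definition ongoing :: "'a pair_pre_digraph \<Rightarrow> ('a \<Rightarrow> real) \<Rightarrow> 'a round list \<Rightarrow> bool" where
  "ongoing D lam h \<longleftrightarrow> \<not> painter_won D h \<and> \<not> lister_won D lam h"

text \<open>A strategy computes Painter's reply from the history and Lister's current move. It must
  give a legal reply to every legal move, also after histories that it never reaches; this is
  no restriction, as replying with the empty set is always legal.\<close>

type_synonym 'a strategy = "'a round list \<Rightarrow> 'a set \<Rightarrow> ('a \<Rightarrow> real) \<Rightarrow> 'a set"

definition painter_strategy ::
    "'a pair_pre_digraph \<Rightarrow> ('a \<times> 'a) weight_fun \<Rightarrow> 'a strategy \<Rightarrow> bool" where
  "painter_strategy D \<omega> \<sigma> \<longleftrightarrow>
     (\<forall>h X \<tau>. lister_legal D h X \<tau> \<longrightarrow> painter_legal D \<omega> X \<tau> (\<sigma> h X \<tau>))"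

text \<open>The first rounds of the play in which Painter follows \<open>\<sigma>\<close> and Lister's successive moves are
  \<open>(X 0, \<tau> 0), (X 1, \<tau> 1), \<dots>\<close>.\<close>

primrec play ::
    "'a strategy \<Rightarrow> (nat \<Rightarrow> 'a set) \<Rightarrow> (nat \<Rightarrow> 'a \<Rightarrow> real) \<Rightarrow> nat \<Rightarrow> 'a round list" where
  "play \<sigma> X \<tau> 0 = []"
| "play \<sigma> X \<tau> (Suc k) =
     play \<sigma> X \<tau> k @ [Round (X k) (\<tau> k) (\<sigma> (play \<sigma> X \<tau> k) (X k) (\<tau> k))]"

text \<open>Painter's replies being determined by \<open>\<sigma>\<close>, Lister's ways of playing against \<open>\<sigma>\<close> are exactly
  the sequences of moves that are legal for as long as the game lasts (the moves after its end
  are irrelevant). Painter has to win each of these plays after finitely many rounds; a play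
  that goes on forever is not won.\<close>

definition winning_strategy ::
    "'a pair_pre_digraph \<Rightarrow> ('a \<times> 'a) weight_fun \<Rightarrow> ('a \<Rightarrow> real) \<Rightarrow> 'a strategy \<Rightarrow> bool" where
  "winning_strategy D \<omega> lam \<sigma> \<longleftrightarrow>
     painter_strategy D \<omega> \<sigma> \<and>
     (\<forall>X \<tau>.
        (\<forall>k. (\<forall>j\<le>k. ongoing D lam (play \<sigma> X \<tau> j)) \<longrightarrow>
              lister_legal D (play \<sigma> X \<tau> k) (X k) (\<tau> k)) \<longrightarrow>
        (\<exists>m. painter_won D (play \<sigma> X \<tau> m) \<and>
              (\<forall>k<m. ongoing D lam (play \<sigma> X \<tau> k))))"

definition ranked_majority_paintable ::
    "'a pair_pre_digraph \<Rightarrow> ('a \<times> 'a) weight_fun \<Rightarrow> ('a \<Rightarrow> real) \<Rightarrow> bool" where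
  "ranked_majority_paintable D \<omega> lam \<longleftrightarrow> (\<exists>\<sigma>. winning_strategy D \<omega> lam \<sigma>)"

end

theory Submission
  imports Defs
begin

text \<open>In each round, Painter can choose \<open>Y \<subseteq> X\<close> such that the weight from \<open>v\<close> into \<open>Y\<close> is at most
  \<open>\<tau> v\<close> times the degree of \<open>v\<close> if \<open>v \<in> Y\<close>, and strictly larger if \<open>v \<in> X - Y\<close>: take an
  inclusion-maximal maximizer of \<open>(\<Sum>v\<in>Y. \<tau> v * degree v)\<close> minus the weight of the edges inside \<open>Y\<close>.
  Each rejection of a vertex is then paid for by the weight to its newly colored neighbors.
  As these are different in different rounds, the tolerances that an uncolored vertex has been
  offered stay below 1. Moreover \<open>Y \<noteq> {}\<close>, so the game is over after at most \<open>card V\<close> rounds.\<close>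

text \<open>Optimality is tested one vertex at a time: removing \<open>v\<close> from
  \<open>Y\<close> gives the upper bound at \<open>v\<close>, and adding \<open>v\<close> gives the
  strict lower bound.\<close>

lemma ex_threshold_kernel:
  fixes a :: "'a \<Rightarrow> 'a \<Rightarrow> real" and t :: "'a \<Rightarrow> real"
  assumes fin: "finite X" and sym: "\<And>u v. a u v = a v u" and irrefl: "\<And>v. a v v = 0"
  shows "\<exists>Y\<subseteq>X. (\<forall>v\<in>Y. (\<Sum>w\<in>Y. a v w) \<le> t v) \<and> (\<forall>v\<in>X - Y. t v < (\<Sum>w\<in>Y. a v w))"
proof -
  \<comment> \<open>The double sum meets each edge inside \<open>Y\<close> from both ends, hence the
    factor 2 at \<open>t v\<close>.\<close>
  define F where "F Y = (\<Sum>v\<in>Y. 2 * t v - (\<Sum>w\<in>Y. a v w))" for Y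
  have F_insert: "F (insert v Y) = F Y + 2 * (t v - (\<Sum>w\<in>Y. a v w))"
    if "finite Y" "v \<notin> Y" for v Y
  proof -
    have "F (insert v Y) = 2 * t v - (\<Sum>w\<in>Y. a v w) + (\<Sum>u\<in>Y. 2 * t u - (\<Sum>w\<in>Y. a u w) - a u v)"
      using that unfolding F_def by (simp add: irrefl algebra_simps)
    also have "\<dots> = 2 * t v - (\<Sum>w\<in>Y. a v w) + F Y - (\<Sum>u\<in>Y. a u v)"
      unfolding F_def by (simp add: sum_subtractf)
    also have "(\<Sum>u\<in>Y. a u v) = (\<Sum>u\<in>Y. a v u)"
      by (rule sum.cong[OF refl sym])
    finally show ?thesis by simp
  qed
  define M where "M = {Y \<in> Pow X. \<forall>Z\<in>Pow X. F Z \<le> F Y}"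
  have "finite (F ` Pow X)" "F ` Pow X \<noteq> {}"
    using fin by auto
  then obtain Y0 where "Y0 \<in> Pow X" "F Y0 = Max (F ` Pow X)"
    by (metis Max_in imageE)
  then have "Y0 \<in> M"
    using fin by (auto simp: M_def)
  moreover have "finite M"
    using fin by (simp add: M_def)
  ultimately obtain Y where Y: "Y \<in> M" and maximal: "\<And>Z. Z \<in> M \<Longrightarrow> Y \<subseteq> Z \<Longrightarrow> Y = Z"
    using finite_has_maximal[of M] by auto
  have "Y \<subseteq> X" and max: "\<And>Z. Z \<subseteq> X \<Longrightarrow> F Z \<le> F Y"
    using Y by (auto simp: M_def)
  then have "finite Y"
    using fin finite_subset by blast
  have "(\<Sum>w\<in>Y. a v w) \<le> t v" if "v \<in> Y" for v
  proof -
    have "F Y = F (Y - {v}) + 2 * (t v - (\<Sum>w\<in>Y - {v}. a v w))"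
      using F_insert[of "Y - {v}" v] \<open>finite Y\<close> that by (simp add: insert_absorb)
    moreover have "(\<Sum>w\<in>Y - {v}. a v w) = (\<Sum>w\<in>Y. a v w)"
      using \<open>finite Y\<close> that by (simp add: sum_diff1 irrefl)
    ultimately show ?thesis
      using max[of "Y - {v}"] \<open>Y \<subseteq> X\<close> by auto
  qed
  moreover have "t v < (\<Sum>w\<in>Y. a v w)" if "v \<in> X - Y" for v
  proof (rule ccontr)
    assume "\<not> t v < (\<Sum>w\<in>Y. a v w)"
    \<comment> \<open>A tie is possible here, so maximality of \<open>F Y\<close> alone gives no
      contradiction; the larger set is then a maximizer too, against inclusion-maximality.\<close>
    then have "F Y \<le> F (insert v Y)"
      using F_insert[of Y v] \<open>finite Y\<close> that by simp
    then have "insert v Y \<in> M"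
      using Y that by (auto simp: M_def intro: order_trans)
    then show False
      using maximal[of "insert v Y"] that by auto
  qed
  ultimately show ?thesis
    using \<open>Y \<subseteq> X\<close> by blast
qed

definition out_weight ::
    "'a pair_pre_digraph \<Rightarrow> ('a \<times> 'a) weight_fun \<Rightarrow> 'a \<Rightarrow> 'a set \<Rightarrow> real" where
  "out_weight D \<omega> v S = (\<Sum>w | (v, w) \<in> parcs D \<and> w \<in> S. \<omega> (v, w))"

definition offered :: "'a round list \<Rightarrow> 'a \<Rightarrow> real" where
  "offered h v = (\<Sum>i | i < length h \<and> v \<in> presented (h ! i). tolerance (h ! i) v)"

lemma offered_Nil [simp]: "offered [] v = 0"
  by (simp add: offered_def)

lemma offered_snoc:
  "offered (h @ [r]) v = offered h v + (if v \<in> presented r then tolerance r v else 0)"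
proof -
  have "{i. i < length (h @ [r]) \<and> v \<in> presented ((h @ [r]) ! i)} =
      {i. i < length h \<and> v \<in> presented (h ! i)} \<union> (if v \<in> presented r then {length h} else {})"
    by (auto simp: nth_append less_Suc_eq split: if_splits)
  then have "offered (h @ [r]) v =
      (\<Sum>i | i < length h \<and> v \<in> presented (h ! i). tolerance ((h @ [r]) ! i) v)
      + (if v \<in> presented r then tolerance r v else 0)"
    unfolding offered_def by (auto simp: nth_append)
  also have "(\<Sum>i | i < length h \<and> v \<in> presented (h ! i). tolerance ((h @ [r]) ! i) v) = offered h v"
    unfolding offered_def by (rule sum.cong) (auto simp: nth_append)
  finally show ?thesis .
qed

lemma colored_Nil [simp]: "colored [] = {}"
  by (simp add: colored_def)

lemma colored_snoc [simp]: "colored (h @ [r]) = colored h \<union> painted r"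
  by (auto simp: colored_def)

context pos_weighted_digraph
begin

abbreviation "W \<equiv> out_weight D \<omega>"

abbreviation "deg v \<equiv> W v UNIV"

lemma finite_out_arcs: "finite {w. (v, w) \<in> parcs D \<and> P w}"
  by (rule finite_subset[OF _ pair_finite_verts]) (auto dest: in_arcsD2)

lemma out_weight_mono: "S \<subseteq> T \<Longrightarrow> W v S \<le> W v T"
  unfolding out_weight_def
  by (rule sum_mono2[OF finite_out_arcs]) (auto intro: less_imp_le weight_pos)

lemma out_weight_nonneg: "0 \<le> W v S"
  unfolding out_weight_def by (rule sum_nonneg) (auto intro: less_imp_le weight_pos)

lemma out_weight_disjoint_Un: "S \<inter> T = {} \<Longrightarrow> W v (S \<union> T) = W v S + W v T"
  unfolding out_weight_def
  by (subst sum.union_disjoint[symmetric]) (auto intro!: finite_out_arcs sum.cong)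

definition greedy_reply :: "'a set \<Rightarrow> ('a \<Rightarrow> real) \<Rightarrow> 'a set \<Rightarrow> bool" where
  "greedy_reply X \<tau> Y \<longleftrightarrow>
     Y \<subseteq> X \<and> (\<forall>v\<in>Y. W v Y \<le> \<tau> v * deg v) \<and> (\<forall>v\<in>X - Y. \<tau> v * deg v < W v Y)"

text \<open>An empty reply would reject some \<open>v\<close> at the price
  \<open>W v {} = 0\<close>, although \<open>\<tau> v * deg v\<close> is nonnegative.\<close>

lemma greedy_reply_nonempty:
  assumes "greedy_reply X \<tau> Y" "X \<noteq> {}" "\<And>v. v \<in> X \<Longrightarrow> 0 \<le> \<tau> v"
  shows "Y \<noteq> {}"
proof
  assume "Y = {}"
  obtain v where "v \<in> X" using assms(2) by blast
  then have "\<tau> v * deg v < 0"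
    using assms(1) \<open>Y = {}\<close> by (auto simp: greedy_reply_def out_weight_def)
  moreover have "0 \<le> \<tau> v * deg v"
    using assms(3) \<open>v \<in> X\<close> out_weight_nonneg by simp
  ultimately show False by simp
qed

text \<open>The case \<open>offered h v = 0\<close> covers vertices not yet presented, where both
  sides of the inequality may be 0. Strictness matters because Lister already wins at a total of
  exactly 1.\<close>

definition rejections_paid :: "'a round list \<Rightarrow> bool" where
  "rejections_paid h \<longleftrightarrow> colored h \<subseteq> pverts D \<and>
     (\<forall>v\<in>pverts D - colored h. offered h v = 0 \<or> offered h v * deg v < W v (colored h))"

text \<open>A total of at least 1 would force \<open>deg v < deg v\<close>. Without a division by
  \<open>deg v\<close>, isolated vertices are included.\<close>

lemma rejections_paid_not_lister_won:
  assumes "rejections_paid h"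
  shows "\<not> lister_won D (\<lambda>v. 1) h"
proof
  assume "lister_won D (\<lambda>v. 1) h"
  then obtain v where v: "v \<in> pverts D - colored h" "1 \<le> offered h v"
    by (auto simp: lister_won_def offered_def)
  then have "offered h v * deg v < W v (colored h)"
    using assms by (force simp: rejections_paid_def)
  also have "\<dots> \<le> 1 * deg v"
    using out_weight_mono[of _ UNIV] by simp
  also have "\<dots> \<le> offered h v * deg v"
    using v(2) out_weight_nonneg by (rule mult_right_mono)
  finally show False by simp
qed

text \<open>\<open>Y\<close> is disjoint from the old colored set, so its weight is added to the
  right-hand side; a rejection adds strictly less to the left.\<close>

lemma rejections_paid_snoc:
  assumes paid: "rejections_paid h" and legal: "lister_legal D h X \<tau>"
    and greedy: "greedy_reply X \<tau> Y"
  shows "rejections_paid (h @ [Round X \<tau> Y])"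
  unfolding rejections_paid_def
proof (intro conjI ballI)
  have "Y \<subseteq> pverts D" and disj: "colored h \<inter> Y = {}"
    using legal greedy by (auto simp: lister_legal_def greedy_reply_def)
  then show "colored (h @ [Round X \<tau> Y]) \<subseteq> pverts D"
    using paid by (simp add: rejections_paid_def)
  fix v
  assume v: "v \<in> pverts D - colored (h @ [Round X \<tau> Y])"
  then have old: "offered h v = 0 \<or> offered h v * deg v < W v (colored h)"
    using paid by (simp add: rejections_paid_def)
  have "\<tau> v * deg v < W v Y" if "v \<in> X"
    using greedy v that by (simp add: greedy_reply_def)
  then show "offered (h @ [Round X \<tau> Y]) v = 0 \<or>
      offered (h @ [Round X \<tau> Y]) v * deg v < W v (colored (h @ [Round X \<tau> Y]))"
    using old out_weight_nonneg[of v "colored h"] out_weight_nonneg[of v Y]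
    by (auto simp: offered_snoc out_weight_disjoint_Un[OF disj] distrib_right)
qed

lemma greedy_reply_winning:
  assumes greedy: "\<And>h X \<tau>. lister_legal D h X \<tau> \<Longrightarrow> greedy_reply X \<tau> (\<sigma> h X \<tau>)"
  shows "winning_strategy D \<omega> (\<lambda>v. 1) \<sigma>"
  unfolding winning_strategy_def
proof (intro conjI allI impI)
  show "painter_strategy D \<omega> \<sigma>"
    unfolding painter_strategy_def painter_legal_def
    using greedy by (simp add: greedy_reply_def out_weight_def)
next
  fix X \<tau>
  let ?h = "play \<sigma> X \<tau>"
  assume legal: "\<forall>k. (\<forall>j\<le>k. ongoing D (\<lambda>v. 1) (?h j)) \<longrightarrow> lister_legal D (?h k) (X k) (\<tau> k)"
  \<comment> \<open>Only Painter's not having won is assumed: that Lister has not won follows from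
    the invariant. All \<open>j \<le> k\<close> are included because \<open>legal\<close> asks for
    an ongoing game at each of them.\<close>
  have inv: "(\<forall>j\<le>k. rejections_paid (?h j)) \<and> k \<le> card (colored (?h k))"
    if "\<forall>j<k. \<not> painter_won D (?h j)" for k
    using that
  proof (induction k)
    case 0
    then show ?case by (simp add: rejections_paid_def)
  next
    case (Suc k)
    then have paid: "\<forall>j\<le>k. rejections_paid (?h j)" and card: "k \<le> card (colored (?h k))"
      by auto
    then have "lister_legal D (?h k) (X k) (\<tau> k)"
      using Suc.prems legal rejections_paid_not_lister_won by (simp add: ongoing_def less_Suc_eq_le)
    moreover define Y where "Y = \<sigma> (?h k) (X k) (\<tau> k)"
    ultimately have move: "lister_legal D (?h k) (X k) (\<tau> k)" "greedy_reply (X k) (\<tau> k) Y"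
      using greedy by auto
    have new: "rejections_paid (?h (Suc k))"
      using rejections_paid_snoc[OF _ move] paid by (simp add: Y_def)
    have "Y \<noteq> {}" "colored (?h k) \<inter> Y = {}"
      using move greedy_reply_nonempty[OF move(2)]
      by (auto simp: lister_legal_def greedy_reply_def)
    then have "colored (?h k) \<subset> colored (?h (Suc k))"
      by (auto simp: Y_def)
    moreover have "finite (colored (?h (Suc k)))"
      using new finite_subset[OF _ pair_finite_verts] by (simp only: rejections_paid_def)
    ultimately have "card (colored (?h k)) < card (colored (?h (Suc k)))"
      by (rule psubset_card_mono[rotated])
    then show ?case
      using paid card new by (auto simp: le_Suc_eq simp del: play.simps)
  qed
  have "\<exists>m. painter_won D (?h m)"
  proof (rule ccontr)
    assume "\<nexists>m. painter_won D (?h m)"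
    \<comment> \<open>One round more than there are vertices would color more vertices than
      exist.\<close>
    then have "rejections_paid (?h (Suc (card (pverts D))))"
      and "Suc (card (pverts D)) \<le> card (colored (?h (Suc (card (pverts D)))))"
      using inv[of "Suc (card (pverts D))"] by blast+
    then show False
      using card_mono[OF pair_finite_verts, of "colored (?h (Suc (card (pverts D))))"]
      by (simp add: rejections_paid_def del: play.simps)
  qed
  then obtain m where m: "painter_won D (?h m)" "\<forall>k<m. \<not> painter_won D (?h k)"
    using exists_least_iff[of "\<lambda>m. painter_won D (?h m)"] by blast
  then have "\<forall>k<m. ongoing D (\<lambda>v. 1) (?h k)"
    using inv[of m] rejections_paid_not_lister_won by (simp add: ongoing_def)
  with m(1) show "\<exists>m. painter_won D (?h m) \<and> (\<forall>k<m. ongoing D (\<lambda>v. 1) (?h k))"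
    by (intro exI conjI)
qed

end

text \<open>Symmetry of the graph enters here, through the kernel lemma with threshold
  \<open>\<tau> v * deg v\<close>.\<close>

lemma (in pos_weighted_graph) ex_greedy_reply:
  assumes "finite X"
  shows "\<exists>Y. greedy_reply X \<tau> Y"
proof -
  \<comment> \<open>The value 0 off the arcs makes \<open>a\<close> symmetric on all pairs and, by
    looplessness, zero on the diagonal.\<close>
  define a where "a v w = (if (v, w) \<in> parcs D then \<omega> (v, w) else 0)" for v w
  have W: "W v Y = (\<Sum>w\<in>Y. a v w)" if "Y \<subseteq> X" for v Y
  proof -
    have "finite Y" using that assms by (rule finite_subset)
    then have "(\<Sum>w\<in>Y. a v w) = (\<Sum>w | w \<in> Y \<and> (v, w) \<in> parcs D. \<omega> (v, w))"
      unfolding a_def by (rule sum.inter_filter[symmetric])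
    then show ?thesis by (simp add: out_weight_def conj_commute)
  qed
  have "a u v = a v u" for u v
    using weight_sym[of u v] arcs_symmetric[of u v] arcs_symmetric[of v u] by (auto simp: a_def)
  moreover have "a v v = 0" for v
    using no_loops[of "(v, v)"] by (auto simp: a_def)
  ultimately obtain Y where "Y \<subseteq> X" "\<forall>v\<in>Y. (\<Sum>w\<in>Y. a v w) \<le> \<tau> v * deg v"
      "\<forall>v\<in>X - Y. \<tau> v * deg v < (\<Sum>w\<in>Y. a v w)"
    using ex_threshold_kernel[OF assms, of a "\<lambda>v. \<tau> v * deg v"] by blast
  then show ?thesis
    unfolding greedy_reply_def W[OF \<open>Y \<subseteq> X\<close>, symmetric] by blast
qed

theorem theorem2p2:
  fixes G :: "'a pair_pre_digraph" and \<omega> :: "('a \<times> 'a) weight_fun"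
  assumes "pos_weighted_graph G \<omega>"
  shows "ranked_majority_paintable G \<omega> (\<lambda>v. 1)"
proof -
  interpret pos_weighted_graph G \<omega> by fact
  \<comment> \<open>The strategy ignores the history; its value at illegal moves is arbitrary, which
    \<open>painter_strategy\<close> allows.\<close>
  have "greedy_reply X \<tau> (SOME Y. greedy_reply X \<tau> Y)" if "lister_legal G h X \<tau>" for h X \<tau>
  proof -
    have "finite X"
      using that finite_subset[OF _ pair_finite_verts] by (auto simp: lister_legal_def)
    then show ?thesis
      by (rule someI_ex[OF ex_greedy_reply])
  qed
  then show ?thesis
    using greedy_reply_winning[of "\<lambda>h X \<tau>. SOME Y. greedy_reply X \<tau> Y"]
    unfolding ranked_majority_paintable_def by blast
qed

end
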